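(* (1) If $\operatorname{depth}([\mathbb{N}]^\infty)<\mathfrak{d}$, then $\operatorname{add}(\mathfrak{X},\mathfrak{D})=\mathfrak{d}$. (2) If $\operatorname{depth}([\mathbb{N}]^\infty)=\mathfrak{d}$, then $\operatorname{cf}(\mathfrak{d})\le\operatorname{add}(\mathfrak{X},\mathfrak{D})$.
   Context: $[\mathbb{N}]^\infty$ is the family of infinite subsets of $\mathbb{N}$; $A\subset^*B$ means $A\setminus B$ finite and $B\setminus A$ infinite. $\operatorname{depth}([\mathbb{N}]^\infty)$ is the minimal cardinal $\kappa$ such that there is no $\subset^*$-decreasing $\kappa$-sequence in $[\mathbb{N}]^\infty$. $f\le^*g$ means $f(n)\le g(n)$ for all but finitely many $n$; $Y\subseteq\mathbb{N}^{\mathbb{N}}$ is dominating if it is $\le^*$-cofinal; $\mathfrak{d}$ is the minimal size of a dominating set. $g$ avoids middles in $Y$ if $\{n:f(n)<g(n)\}$ is infinite for each $f\in Y$ and for all $f,h\in Y$ one of $\{n:f(n)<g(n)\le h(n)\}$, $\{n:h(n)<g(n)\le f(n)\}$ is finite. $\mathfrak{X}$ is the class of $Y\subseteq\mathbb{N}^{\mathbb{N}}$ for which some $g$ avoids middles in $Y$; $\mathfrak{D}$ the class of non-dominating subsets. $\operatorname{add}(\mathfrak{X},\mathfrak{D})$ is the minimal cardinality of $\mathcal{F}\subseteq\mathfrak{X}$ with $\bigcup\mathcal{F}$ dominating. *)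

theory Defs
  imports Main
begin

unbundle cardinal_syntax

text \<open>
  Cardinals are represented by the cardinal orders of the library, compared by \<open>\<le>o\<close>, \<open><o\<close>
  and \<open>=o\<close>.
\<close>

section \<open>Cardinals given as minima\<close>

definition min_card :: "'a set set \<Rightarrow> 'a rel" where
  "min_card S = |SOME A. A \<in> S \<and> (\<forall>B\<in>S. |A| \<le>o |B| )|"

text \<open>If \<open>S\<close> is empty, then \<open>min_card S\<close> is arbitrary. Otherwise it is the minimum:\<close>

lemma
  assumes "S \<noteq> {}"
  shows min_card_attained: "\<exists>A\<in>S. min_card S = |A|"
    and min_card_le: "B \<in> S \<Longrightarrow> min_card S \<le>o |B|"
proof -
  have "\<exists>r\<in>card_of ` S. \<forall>r'\<in>card_of ` S. r \<le>o r'"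
    by (rule exists_minim_Card_order) (use assms card_of_Card_order in auto)
  then have ex: "\<exists>A. A \<in> S \<and> (\<forall>B\<in>S. |A| \<le>o |B| )" by auto
  note * = someI_ex[OF ex]
  show "\<exists>A\<in>S. min_card S = |A|" using * unfolding min_card_def by blast
  show "min_card S \<le>o |B|" if "B \<in> S" using * that unfolding min_card_def by blast
qed

section \<open>Depth\<close>

definition almost_psubset :: "nat set \<Rightarrow> nat set \<Rightarrow> bool"  (infix "\<subset>*" 50) where
  "A \<subset>* B \<longleftrightarrow> finite (A - B) \<and> infinite (B - A)"

definition infinite_sets :: "nat set set" where
  "infinite_sets = {A. infinite A}"

text \<open>A \<open>\<kappa>\<close>-sequence is indexed by the field of the cardinal order \<open>\<kappa>\<close>,
  which plays the role of the set of ordinals below \<open>\<kappa>\<close>.\<close>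

definition decreasing_seq :: "'i rel \<Rightarrow> nat set set \<Rightarrow> ('i \<Rightarrow> nat set) \<Rightarrow> bool" where
  "decreasing_seq \<kappa> P s \<longleftrightarrow>
     s ` Field \<kappa> \<subseteq> P \<and> (\<forall>i j. (i, j) \<in> \<kappa> \<and> i \<noteq> j \<longrightarrow> s j \<subset>* s i)"

text \<open>A decreasing sequence is injective, so the depth is at most the successor of the continuum.
  It is therefore enough to let \<open>|K|\<close> range over the cardinals up to \<open>|UNIV :: nat set set set|\<close>;
  see \<open>depth_least\<close> below, where the cardinal lives on an arbitrary type.\<close>

definition depth :: "nat set set \<Rightarrow> nat set set rel" where
  "depth P = min_card {K. \<nexists>s. decreasing_seq (card_of K) P s}"

section \<open>Domination\<close>

definition le_star :: "(nat \<Rightarrow> nat) \<Rightarrow> (nat \<Rightarrow> nat) \<Rightarrow> bool"  (infix "\<le>*" 50) where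
  "f \<le>* g \<longleftrightarrow> finite {n. \<not> f n \<le> g n}"

definition dominating :: "(nat \<Rightarrow> nat) set \<Rightarrow> bool" where
  "dominating Y \<longleftrightarrow> (\<forall>f. \<exists>g\<in>Y. f \<le>* g)"

definition dom_number :: "(nat \<Rightarrow> nat) rel"  ("\<dd>") where
  "\<dd> = min_card {Y. dominating Y}"

section \<open>Avoiding middles and additivity\<close>

definition avoids_middles :: "(nat \<Rightarrow> nat) \<Rightarrow> (nat \<Rightarrow> nat) set \<Rightarrow> bool" where
  "avoids_middles g Y \<longleftrightarrow>
     (\<forall>f\<in>Y. infinite {n. f n < g n}) \<and>
     (\<forall>f\<in>Y. \<forall>h\<in>Y. finite {n. f n < g n \<and> g n \<le> h n} \<or> finite {n. h n < g n \<and> g n \<le> f n})"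

definition XX :: "(nat \<Rightarrow> nat) set set"  ("\<XX>") where
  "\<XX> = {Y. \<exists>g. avoids_middles g Y}"

definition DD :: "(nat \<Rightarrow> nat) set set"  ("\<DD>") where
  "\<DD> = {Y. \<not> dominating Y}"

definition add :: "'a set set \<Rightarrow> 'a set set \<Rightarrow> 'a set rel" where
  "add I J = min_card {F. F \<subseteq> I \<and> \<Union>F \<notin> J}"

section \<open>Cofinality\<close>

text \<open>The predicate \<open>cofinal\<close> of the library asks for strictly larger elements, as needed for the
  cofinality of an infinite cardinal (a limit ordinal). For a finite nonzero \<open>r\<close> there are no
  cofinal sets in this sense.\<close>

definition cf :: "'a rel \<Rightarrow> 'a rel" where
  "cf r = min_card {K. K \<subseteq> Field r \<and> cofinal K r}"

section \<open>All these minima exist\<close>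

lemma decreasing_seq_inj:
  assumes "Well_order \<kappa>" "decreasing_seq \<kappa> P s"
  shows "inj_on s (Field \<kappa>)"
proof (rule inj_onI, rule ccontr)
  fix i j assume ij: "i \<in> Field \<kappa>" "j \<in> Field \<kappa>" "s i = s j" "i \<noteq> j"
  then have "(i, j) \<in> \<kappa> \<or> (j, i) \<in> \<kappa>"
    using assms(1) by (auto simp: order_on_defs total_on_def)
  with ij assms(2) have "s i \<subset>* s i" unfolding decreasing_seq_def by metis
  then show False by (simp add: almost_psubset_def)
qed

lemma no_long_decreasing_seq: "\<not> decreasing_seq |UNIV :: nat set set set| P s"
proof
  assume "decreasing_seq |UNIV :: nat set set set| P s"
  then have "inj_on s UNIV"
    using decreasing_seq_inj[OF card_of_Well_order] by (metis Field_card_of)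
  then have "surj (inv s)" by (rule inj_imp_surj_inv)
  then show False using Cantors_theorem[of UNIV] by (metis Pow_UNIV)
qed

lemma decreasing_seq_embed:
  assumes "\<kappa>' \<le>o \<kappa>" "decreasing_seq \<kappa> P s"
  shows "\<exists>s'. decreasing_seq \<kappa>' P s'"
proof -
  from assms(1) obtain f where wo: "Well_order \<kappa>'" "Well_order \<kappa>" and f: "embed \<kappa>' \<kappa> f"
    unfolding ordLeq_def by auto
  have inj: "inj_on f (Field \<kappa>')" by (rule embed_inj_on[OF wo(1) f])
  have comp: "(f i, f j) \<in> \<kappa>" if "(i, j) \<in> \<kappa>'" for i j
    using embed_compat[OF f] that by (auto simp: compat_def)
  have fld: "f ` Field \<kappa>' \<subseteq> Field \<kappa>" by (rule embed_Field[OF f])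
  have "decreasing_seq \<kappa>' P (s \<circ> f)"
    unfolding decreasing_seq_def
  proof (intro conjI allI impI)
    show "(s \<circ> f) ` Field \<kappa>' \<subseteq> P"
      using fld assms(2) by (auto simp: decreasing_seq_def)
  next
    fix i j assume ij: "(i, j) \<in> \<kappa>' \<and> i \<noteq> j"
    then have "i \<in> Field \<kappa>'" "j \<in> Field \<kappa>'" by (auto simp: Field_def)
    with ij inj have "f i \<noteq> f j" by (auto dest: inj_onD)
    with comp ij assms(2) show "(s \<circ> f) j \<subset>* (s \<circ> f) i"
      by (auto simp: decreasing_seq_def)
  qed
  then show ?thesis by blast
qed

lemma depth_set_nonempty: "{K :: nat set set set. \<nexists>s. decreasing_seq (card_of K) P s} \<noteq> {}"
  using no_long_decreasing_seq by blast

lemma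
  shows Card_order_depth: "Card_order (depth P)"
    and no_decreasing_seq_depth: "\<nexists>s. decreasing_seq (depth P) P s"
  using min_card_attained[OF depth_set_nonempty, of P] card_of_Card_order unfolding depth_def by auto

lemma depth_least:
  fixes \<kappa> :: "'i rel"
  assumes "Card_order \<kappa>" and no: "\<nexists>s. decreasing_seq \<kappa> P s"
  shows "depth P \<le>o \<kappa>"
proof (rule ccontr)
  assume "\<not> depth P \<le>o \<kappa>"
  then have "\<kappa> <o depth P"
    using not_ordLeq_iff_ordLess[of \<kappa> "depth P"] assms(1) Card_order_depth[of P]
    unfolding card_order_on_def by blast
  then obtain p where p: "Field p \<subseteq> Field (depth P)" "\<kappa> =o p" "p <o depth P"
    using internalize_ordLess[of \<kappa> "depth P"] by blast
  have pC: "Card_order p" using assms(1) p(2) Card_order_ordIso2 by blast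
  then have iso: "|Field p| =o p" by (rule card_of_Field_ordIso)
  have "\<kappa> =o |Field p|" using p(2) iso ordIso_symmetric ordIso_transitive by blast
  then have "\<nexists>s. decreasing_seq |Field p| P s"
    using no decreasing_seq_embed ordIso_iff_ordLeq by blast
  then have "depth P \<le>o |Field p|"
    unfolding depth_def by (intro min_card_le[OF depth_set_nonempty]) simp
  then have "depth P \<le>o p" using iso ordLeq_ordIso_trans by blast
  with p(3) show False using not_ordLess_ordLeq by blast
qed

lemma dominating_UNIV: "dominating UNIV"
proof -
  have "f \<le>* f" for f by (simp add: le_star_def)
  then show ?thesis unfolding dominating_def by blast
qed

lemma dominating_infinite:
  assumes "dominating Y" shows "infinite Y"
proof
  assume fin: "finite Y"
  define f where "f n = Suc (\<Sum>g\<in>Y. g n)" for n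
  obtain g where g: "g \<in> Y" "f \<le>* g" using assms unfolding dominating_def by blast
  have "g n < f n" for n
    using member_le_sum[of g Y "\<lambda>h. h n"] fin g(1) by (simp add: f_def less_Suc_eq_le)
  then have "{n. \<not> f n \<le> g n} = UNIV" by (simp add: not_le)
  with g(2) show False by (simp add: le_star_def)
qed

lemma dom_number_attained: "\<exists>Y. dominating Y \<and> \<dd> = |Y|"
  using min_card_attained[of "{Y. dominating Y}"] dominating_UNIV
  unfolding dom_number_def by auto

lemma singleton_in_XX: "{f} \<in> \<XX>"
proof -
  have "avoids_middles (\<lambda>n. Suc (f n)) {f}" by (simp add: avoids_middles_def)
  then show ?thesis unfolding XX_def by blast
qed

lemma add_XX_DD_nonempty: "{F. F \<subseteq> \<XX> \<and> \<Union>F \<notin> \<DD>} \<noteq> {}"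
proof -
  have "range (\<lambda>f :: nat \<Rightarrow> nat. {f}) \<subseteq> \<XX>" using singleton_in_XX by auto
  moreover have "\<Union>(range (\<lambda>f :: nat \<Rightarrow> nat. {f})) \<notin> \<DD>"
    using dominating_UNIV by (simp add: DD_def)
  ultimately show ?thesis by blast
qed

lemma cf_dom_number_nonempty: "{K. K \<subseteq> Field \<dd> \<and> cofinal K \<dd>} \<noteq> {}"
proof -
  obtain Y where Y: "dominating Y" "\<dd> = |Y|" using dom_number_attained by blast
  then have "cofinal (Field \<dd>) \<dd>"
    unfolding cofinal_def
    using infinite_Card_order_limit[OF card_of_Card_order, of Y] dominating_infinite
    by (metis Field_card_of)
  then show ?thesis by blast
qed

end

theory Submission
  imports Defs
begin

text \<open>
  A function \<open>g\<close> avoids middles in \<open>Y\<close> exactly if the sets \<open>{n. f n < g n}\<close>, \<open>f \<in> Y\<close>, are infinite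
  and linearly ordered by almost inclusion. Such a family has a coinitial subfamily \<open>C\<close> that forms a
  decreasing sequence, so that \<open>|C|\<close> is less than the depth. If \<open>h\<close> is monotone and \<open>h \<le>* f\<close>, and
  \<open>A \<in> C\<close> is almost included in \<open>{n. f n < g n}\<close>, then \<open>h n\<close> is eventually bounded by the value of \<open>g\<close>
  at the least element of \<open>A\<close> above \<open>n\<close>. Hence a family of sets \<open>Y\<close> in \<open>\<XX>\<close> with a dominating union
  yields a dominating set of cardinality at most the sum of the cardinals \<open>|C|\<close>.
\<close>

section \<open>Almost inclusion chains and the depth\<close>

text \<open>Well-order \<open>S\<close> arbitrarily by \<open>w\<close> and keep in \<open>C\<close>
  only the sets strictly almost included in all their predecessors. Restricted to \<open>C\<close>,
  the order \<open>w\<close> is then decreasing. Coinitiality holds because the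
  \<open>w\<close>-least set almost included in a given \<open>B\<close> belongs to
  \<open>C\<close>.\<close>

lemma coinitial_decreasing:
  fixes S :: "nat set set"
  assumes lin: "\<And>A B. A \<in> S \<Longrightarrow> B \<in> S \<Longrightarrow> finite (A - B) \<or> finite (B - A)"
  shows "\<exists>C\<subseteq>S. \<exists>r. well_order_on C r \<and> decreasing_seq r S id \<and> (\<forall>B\<in>S. \<exists>A\<in>C. finite (A - B))"
proof -
  obtain w where w: "well_order_on S w" using well_order_on by blast
  have F: "Field w = S" using w well_order_on_Field by blast
  define C where "C = {A \<in> S. \<forall>B. (B, A) \<in> w \<and> B \<noteq> A \<longrightarrow> A \<subset>* B}"
  have "C \<subseteq> S" by (auto simp: C_def)
  then have wo: "well_order_on C (Restr w C)" using w F by (intro well_order_on_Restr) auto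
  have "decreasing_seq (Restr w C) S id"
    using \<open>C \<subseteq> S\<close> well_order_on_Field[OF wo] by (auto simp: decreasing_seq_def C_def)
  moreover have "\<exists>A\<in>C. finite (A - B)" if B: "B \<in> S" for B
  proof -
    have "wf (w - Id)" using w by (simp add: well_order_on_def)
    moreover have "B \<in> {A \<in> S. finite (A - B)}" using B by simp
    ultimately obtain A where A: "A \<in> S" "finite (A - B)"
      and min: "\<And>B'. (B', A) \<in> w - Id \<Longrightarrow> B' \<notin> {A \<in> S. finite (A - B)}"
      by (metis (no_types, lifting) mem_Collect_eq wfE_min)
    \<comment> \<open>By minimality of \<open>A\<close>, the predecessor \<open>B'\<close> is not
      almost included in \<open>B\<close>, so linearity puts \<open>B\<close> almost inside
      \<open>B'\<close>. Hence \<open>A - B'\<close> is finite; were \<open>B' - A\<close> finite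
      too, \<open>B'\<close> would be almost included in \<open>B\<close> through
      \<open>A\<close>.\<close>
    have "A \<subset>* B'" if B': "(B', A) \<in> w" "B' \<noteq> A" for B'
    proof -
      have "B' \<in> S" using B'(1) F by (auto simp: Field_def)
      with min B' have inf: "infinite (B' - B)" by auto
      then have "finite (B - B')" using lin[OF \<open>B' \<in> S\<close> B] by blast
      moreover have "A - B' \<subseteq> (A - B) \<union> (B - B')" "B' - B \<subseteq> (B' - A) \<union> (A - B)" by auto
      ultimately show ?thesis
        using A(2) inf unfolding almost_psubset_def by (meson finite_Un finite_subset)
    qed
    then have "A \<in> C" using A(1) by (simp add: C_def)
    then show ?thesis using A(2) by blast
  qed
  ultimately show ?thesis using wo \<open>C \<subseteq> S\<close> by blast
qed

text \<open>The order type of \<open>r\<close> may exceed the cardinal of \<open>C\<close>, but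
  \<open>|C|\<close> always embeds into \<open>r\<close>. If the depth were at most
  \<open>|C|\<close>, restricting the sequence along the embedding would give one whose length is
  the depth.\<close>

lemma decreasing_seq_ordLess_depth:
  assumes "well_order_on C r" "decreasing_seq r P s"
  shows "|C| <o depth P"
proof (rule ccontr)
  assume "\<not> |C| <o depth P"
  then have "depth P \<le>o |C|"
    using Card_order_depth[of P] by (metis card_of_Well_order card_order_on_def not_ordLess_iff_ordLeq)
  also have "|C| \<le>o r" using assms(1) by (rule card_of_least)
  finally show False using decreasing_seq_embed[OF _ assms(2)] no_decreasing_seq_depth by blast
qed

section \<open>Bounding monotone functions through infinite sets\<close>

definition next_in :: "nat set \<Rightarrow> nat \<Rightarrow> nat" where
  "next_in A n = (LEAST m. m \<in> A \<and> n \<le> m)"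

lemma next_in:
  assumes "infinite A"
  shows "next_in A n \<in> A" "n \<le> next_in A n"
proof -
  have "\<exists>m. m \<in> A \<and> n \<le> m" using assms unfolding finite_nat_set_iff_bounded by (meson not_le)
  from LeastI_ex[OF this] show "next_in A n \<in> A" "n \<le> next_in A n"
    unfolding next_in_def by auto
qed

text \<open>With \<open>m = next_in A n\<close>, for all large \<open>n\<close> there is the chain
  \<open>h n \<le> h m \<le> f m < g m\<close>. Monotonicity moves the estimate from
  \<open>n\<close> to a point of \<open>A\<close>.\<close>

lemma le_star_next_in:
  assumes "mono h" "h \<le>* f" "infinite A" "finite (A - {n. f n < g n})"
  shows "h \<le>* g \<circ> next_in A"
proof -
  obtain k where k: "\<And>n. k \<le> n \<Longrightarrow> h n \<le> f n"
    using assms(2) unfolding le_star_def finite_nat_set_iff_bounded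
    by (metis mem_Collect_eq not_le)
  obtain l where l: "\<And>n. l \<le> n \<Longrightarrow> n \<in> A \<Longrightarrow> f n < g n"
    using assms(4) unfolding finite_nat_set_iff_bounded
    by (metis DiffI mem_Collect_eq not_le)
  have "h n \<le> (g \<circ> next_in A) n" if "max k l \<le> n" for n
  proof -
    have "n \<le> next_in A n" "next_in A n \<in> A" using next_in[OF assms(3)] by auto
    then show ?thesis
      using that k[of "next_in A n"] l[of "next_in A n"] monoD[OF assms(1), of n "next_in A n"] by simp
  qed
  then have "{n. \<not> h n \<le> (g \<circ> next_in A) n} \<subseteq> {..<max k l}" by (auto simp: not_le[symmetric])
  then show ?thesis unfolding le_star_def using finite_lessThan finite_subset by blast
qed

text \<open>Every function lies below its partial sums, which are monotone; this supplies the
  monotonicity that \<open>le_star_next_in\<close> requires.\<close>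

lemma dominatingI_mono:
  assumes "\<And>h. mono h \<Longrightarrow> \<exists>g\<in>Y. h \<le>* g"
  shows "dominating Y"
  unfolding dominating_def
proof
  fix f :: "nat \<Rightarrow> nat"
  define h where "h n = (\<Sum>i\<le>n. f i)" for n
  have "mono h" unfolding h_def by (intro monoI sum_mono2) auto
  then obtain g where "g \<in> Y" "h \<le>* g" using assms by blast
  moreover have "f n \<le> h n" for n unfolding h_def by (rule member_le_sum) auto
  then have "{n. \<not> f n \<le> g n} \<subseteq> {n. \<not> h n \<le> g n}" using order_trans by blast
  ultimately show "\<exists>g\<in>Y. f \<le>* g" unfolding le_star_def using finite_subset by blast
qed

text \<open>The set \<open>Y\<close>, of any size, is traded for fewer than depth many functions
  \<open>g \<circ> next_in A\<close> that bound every monotone function bounded by a member of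
  \<open>Y\<close>.\<close>

lemma avoids_middles_coinitial:
  assumes "avoids_middles g Y"
  obtains C where "|C| <o depth infinite_sets"
    and "\<And>h f. mono h \<Longrightarrow> f \<in> Y \<Longrightarrow> h \<le>* f \<Longrightarrow> \<exists>A\<in>C. h \<le>* g \<circ> next_in A"
proof -
  define S where "S = (\<lambda>f. {n. f n < g n}) ` Y"
  have S: "S \<subseteq> infinite_sets"
    using assms by (auto simp: S_def avoids_middles_def infinite_sets_def)
  have "finite (A - B) \<or> finite (B - A)" if AB: "A \<in> S" "B \<in> S" for A B
  proof -
    obtain f h where "f \<in> Y" "h \<in> Y" "A = {n. f n < g n}" "B = {n. h n < g n}"
      using AB unfolding S_def by blast
    \<comment> \<open>The differences of members of \<open>S\<close> are exactly the middle sets, so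
      avoiding middles is comparability under almost inclusion.\<close>
    moreover have "{n. f n < g n} - {n. h n < g n} = {n. f n < g n \<and> g n \<le> h n}" for f h
      by auto
    ultimately show ?thesis using assms unfolding avoids_middles_def by simp
  qed
  then have "\<exists>C\<subseteq>S. \<exists>r. well_order_on C r \<and> decreasing_seq r S id \<and> (\<forall>B\<in>S. \<exists>A\<in>C. finite (A - B))"
    by (rule coinitial_decreasing)
  then obtain C r where C: "C \<subseteq> S" "well_order_on C r"
    "decreasing_seq r S id" "\<And>B. B \<in> S \<Longrightarrow> \<exists>A\<in>C. finite (A - B)" by blast
  from C(3) S have "decreasing_seq r infinite_sets id" unfolding decreasing_seq_def by blast
  with C(2) have "|C| <o depth infinite_sets" by (rule decreasing_seq_ordLess_depth)
  moreover have "\<exists>A\<in>C. h \<le>* g \<circ> next_in A" if h: "mono h" "f \<in> Y" "h \<le>* f" for h f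
  proof -
    obtain A where A: "A \<in> C" "finite (A - {n. f n < g n})"
      using C(4)[of "{n. f n < g n}"] h(2) unfolding S_def by blast
    then have "infinite A" using C(1) S by (auto simp: infinite_sets_def)
    then show ?thesis using A le_star_next_in[OF h(1,3)] by blast
  qed
  ultimately show thesis by (rule that)
qed

section \<open>Unions of fewer than \<dd> members of \<XX>\<close>

lemma dom_number_le: "dominating Y \<Longrightarrow> \<dd> \<le>o |Y|"
  unfolding dom_number_def using min_card_le[of "{Y. dominating Y}" Y] by blast

lemma Card_order_dom_number: "Card_order \<dd>"
  using dom_number_attained card_of_Card_order by metis

lemma infinite_Field_dom_number: "infinite (Field \<dd>)"
  using dom_number_attained dominating_infinite by (metis Field_card_of)

text \<open>A uniform bound \<open>|B|\<close> below \<open>r\<close> takes the place of regularity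
  of \<open>r\<close>: the sum \<open>I <+> B\<close> bounds both the index set and every
  \<open>A i\<close>.\<close>

lemma card_of_UNION_ordLess_infinite_Field:
  assumes r: "Card_order r" "infinite (Field r)"
    and "|I| <o r" "|B| <o r" "\<And>i. i \<in> I \<Longrightarrow> |A i| \<le>o |B|"
  shows "|\<Union>i\<in>I. A i| <o r"
proof (cases "finite (I <+> B)")
  \<comment> \<open>The cardinal bound for unions used in the other case is for infinite cardinals,
    so a finite sum is treated separately.\<close>
  case True
  then have "finite (\<Union>i\<in>I. A i)"
    using assms(5) by (auto simp: finite_Plus_iff intro: card_of_ordLeq_finite)
  then show ?thesis
    using r by (metis finite_ordLess_infinite card_of_Well_order card_order_on_def Field_card_of)
next
  case False
  have "|A i| \<le>o |I <+> B|" if "i \<in> I" for i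
    using assms(5)[OF that] card_of_Plus2 ordLeq_transitive by blast
  then have "|\<Union>i\<in>I. A i| \<le>o |I <+> B|"
    using False card_of_Plus1 by (intro card_of_UNION_ordLeq_infinite) auto
  also have "|I <+> B| <o r"
    using card_of_Plus_ordLess_infinite_Field[OF r(2,1)] assms(3,4) by blast
  finally show ?thesis .
qed

text \<open>The hypothesis \<open>bound\<close> holds for small families \<open>F\<close> if the depth is less than \<open>\<dd>\<close>, and by the
  definition of cofinality if it equals \<open>\<dd>\<close>.\<close>

lemma Union_not_dominating:
  assumes F: "F \<subseteq> \<XX>" "|F| <o \<dd>"
    and bound: "\<And>C :: (nat \<Rightarrow> nat) set \<Rightarrow> nat set set. (\<And>Y. Y \<in> F \<Longrightarrow> |C Y| <o depth infinite_sets) \<Longrightarrow>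
      \<exists>B :: 'b set. |B| <o \<dd> \<and> (\<forall>Y\<in>F. |C Y| \<le>o |B| )"
  shows "\<not> dominating (\<Union>F)"
proof
  assume dom: "dominating (\<Union>F)"
  have "\<forall>Y\<in>F. \<exists>g C. |C| <o depth infinite_sets \<and>
      (\<forall>h f. mono h \<longrightarrow> f \<in> Y \<longrightarrow> h \<le>* f \<longrightarrow> (\<exists>A\<in>C. h \<le>* g \<circ> next_in A))"
  proof
    fix Y assume "Y \<in> F"
    then obtain g where "avoids_middles g Y" using F(1) by (auto simp: XX_def)
    then obtain C where "|C| <o depth infinite_sets"
      "\<And>h f. mono h \<Longrightarrow> f \<in> Y \<Longrightarrow> h \<le>* f \<Longrightarrow> \<exists>A\<in>C. h \<le>* g \<circ> next_in A"
      by (rule avoids_middles_coinitial) blast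
    then show "\<exists>g C. |C| <o depth infinite_sets \<and>
      (\<forall>h f. mono h \<longrightarrow> f \<in> Y \<longrightarrow> h \<le>* f \<longrightarrow> (\<exists>A\<in>C. h \<le>* g \<circ> next_in A))" by blast
  qed
  then obtain g C where C: "\<And>Y. Y \<in> F \<Longrightarrow> |C Y| <o depth infinite_sets"
    and g: "\<And>Y h f. Y \<in> F \<Longrightarrow> mono h \<Longrightarrow> f \<in> Y \<Longrightarrow> h \<le>* f \<Longrightarrow> \<exists>A\<in>C Y. h \<le>* g Y \<circ> next_in A"
    by metis
  obtain B :: "'b set" where B: "|B| <o \<dd>" "\<And>Y. Y \<in> F \<Longrightarrow> |C Y| \<le>o |B|"
    using bound[of C] C by metis
  define G where "G Y = (\<lambda>A. g Y \<circ> next_in A) ` C Y" for Y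
  have "|G Y| \<le>o |B|" if "Y \<in> F" for Y
    unfolding G_def using card_of_image B(2)[OF that] ordLeq_transitive by blast
  then have "|\<Union>Y\<in>F. G Y| <o \<dd>"
    using card_of_UNION_ordLess_infinite_Field
      [OF Card_order_dom_number infinite_Field_dom_number F(2) B(1)] by blast
  moreover have "dominating (\<Union>Y\<in>F. G Y)"
  proof (rule dominatingI_mono)
    fix h :: "nat \<Rightarrow> nat" assume "mono h"
    moreover obtain Y f where Y: "Y \<in> F" "f \<in> Y" "h \<le>* f"
      using dom unfolding dominating_def by blast
    ultimately obtain A where "A \<in> C Y" "h \<le>* g Y \<circ> next_in A" using g by blast
    with Y(1) show "\<exists>k\<in>(\<Union>Y\<in>F. G Y). h \<le>* k" unfolding G_def
      by (intro bexI[of _ "g Y \<circ> next_in A"] UN_I[of Y] image_eqI[of _ _ A]) auto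
  qed
  ultimately show False using dom_number_le not_ordLess_ordLeq by blast
qed

lemma add_attained: "\<exists>F\<subseteq>\<XX>. dominating (\<Union>F) \<and> add \<XX> \<DD> = |F|"
  using min_card_attained[OF add_XX_DD_nonempty] unfolding add_def DD_def by auto

text \<open>Split a dominating set of least size into singletons, each of which lies in
  \<XX>.\<close>

lemma add_le_dom_number: "add \<XX> \<DD> \<le>o \<dd>"
proof -
  obtain Y where Y: "dominating Y" "\<dd> = |Y|" using dom_number_attained by blast
  have "(\<lambda>f. {f}) ` Y \<in> {F. F \<subseteq> \<XX> \<and> \<Union>F \<notin> \<DD>}"
    using Y(1) singleton_in_XX by (auto simp: DD_def)
  then have "add \<XX> \<DD> \<le>o |(\<lambda>f. {f}) ` Y|"
    unfolding add_def by (rule min_card_le[OF add_XX_DD_nonempty])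
  then show ?thesis using Y(2) card_of_image ordLeq_transitive by metis
qed

section \<open>Uniform bounds from the cofinality of \<dd>\<close>

lemma cf_attained: "\<exists>K\<subseteq>Field \<dd>. cofinal K \<dd> \<and> cf \<dd> = |K|"
  using min_card_attained[OF cf_dom_number_nonempty] unfolding cf_def by auto

lemma cf_le: "K \<subseteq> Field \<dd> \<Longrightarrow> cofinal K \<dd> \<Longrightarrow> cf \<dd> \<le>o |K|"
  unfolding cf_def using min_card_le[OF cf_dom_number_nonempty, of K] by blast

lemma cf_le_dom_number: "cf \<dd> \<le>o \<dd>"
proof -
  obtain K where "K \<subseteq> Field \<dd>" "cf \<dd> = |K|" using cf_attained by blast
  then show ?thesis
    using card_of_mono1[of K "Field \<dd>"] card_of_Field_ordIso[OF Card_order_dom_number]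
      ordLeq_ordIso_trans by metis
qed

text \<open>A smaller well-order is isomorphic to a proper initial segment. This turns cardinals
  below \<open>r\<close> into elements of its field, where cofinality applies.\<close>

lemma card_of_ordLess_under:
  assumes "Card_order r" "|A| <o r"
  shows "\<exists>a\<in>Field r. |A| \<le>o |under r a|"
proof -
  have wo: "Well_order r" using assms(1) by (simp add: card_order_on_def)
  obtain a where a: "a \<in> Field r" "|A| =o Restr r (underS r a)"
    using assms(2) ordLess_iff_ordIso_Restr[OF wo card_of_Well_order] by blast
  have "|A| \<le>o |Field (Restr r (underS r a))|"
    using card_of_mono2[OF ordIso_imp_ordLeq[OF a(2)]] unfolding Field_card_of .
  also have "|Field (Restr r (underS r a))| \<le>o |under r a|"
    using Field_Restr_subset underS_subset_under by (intro card_of_mono1) (rule subset_trans)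
  finally have "|A| \<le>o |under r a|" .
  then show ?thesis using a(1) by blast
qed

text \<open>An infinite cardinal has no last element, so the closed segment at \<open>a\<close> sits
  inside the open segment at some larger \<open>b\<close>.\<close>

lemma card_of_under_ordLess:
  assumes "Card_order r" "infinite (Field r)" "a \<in> Field r"
  shows "|under r a| <o r"
proof -
  have wo: "Well_order r" using assms(1) by (simp add: card_order_on_def)
  obtain b where b: "b \<in> Field r" "a \<noteq> b" "(a, b) \<in> r"
    using infinite_Card_order_limit[OF assms] by blast
  have "under r a \<subseteq> underS r b"
    using b wo unfolding under_def underS_def order_on_defs
    by (auto dest: transD antisymD)
  then show ?thesis
    using card_of_mono1 card_of_underS[OF assms(1) b(1)] ordLeq_ordLess_trans by blast
qed

lemma uniform_bound_below_cf:
  assumes "|F| <o cf \<dd>" "\<And>Y. Y \<in> F \<Longrightarrow> |C Y| <o \<dd>"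
  shows "\<exists>B :: (nat \<Rightarrow> nat) set. |B| <o \<dd> \<and> (\<forall>Y\<in>F. |C Y| \<le>o |B| )"
proof -
  have "\<forall>Y\<in>F. \<exists>a\<in>Field \<dd>. |C Y| \<le>o |under \<dd> a|"
    using card_of_ordLess_under[OF Card_order_dom_number] assms(2) by blast
  then obtain a where a: "\<And>Y. Y \<in> F \<Longrightarrow> a Y \<in> Field \<dd>" "\<And>Y. Y \<in> F \<Longrightarrow> |C Y| \<le>o |under \<dd> (a Y)|"
    by metis
  have "|a ` F| <o cf \<dd>" using card_of_image assms(1) by (rule ordLeq_ordLess_trans)
  then have "\<not> cofinal (a ` F) \<dd>"
    using cf_le[of "a ` F"] a(1) not_ordLess_ordLeq by blast
  \<comment> \<open>As \<open>cofinal\<close> asks for strictly larger elements, its failure yields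
    a \<open>b\<close> with no \<open>a Y\<close> strictly above it; totality then puts every
    \<open>a Y\<close> at or below \<open>b\<close>.\<close>
  then obtain b where b: "b \<in> Field \<dd>" "\<And>Y. Y \<in> F \<Longrightarrow> b = a Y \<or> (b, a Y) \<notin> \<dd>"
    unfolding cofinal_def by blast
  have wo: "Well_order \<dd>" using Card_order_dom_number by (simp add: card_order_on_def)
  have "(a Y, b) \<in> \<dd>" if "Y \<in> F" for Y
    using wo b(1) b(2)[OF that] a(1)[OF that]
    by (cases "b = a Y") (auto simp: order_on_defs total_on_def refl_on_def)
  then have sub: "under \<dd> (a Y) \<subseteq> under \<dd> b" if "Y \<in> F" for Y
    using that wo unfolding under_def order_on_defs by (auto dest: transD)
  then have "\<forall>Y\<in>F. |C Y| \<le>o |under \<dd> b|"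
    using ordLeq_transitive[OF a(2) card_of_mono1[OF sub]] by blast
  then show ?thesis
    using card_of_under_ordLess[OF Card_order_dom_number infinite_Field_dom_number b(1)] by blast
qed

theorem theorem4p9:
  shows "(depth infinite_sets <o \<dd> \<longrightarrow> add \<XX> \<DD> =o \<dd>) \<and>
         (depth infinite_sets =o \<dd> \<longrightarrow> cf \<dd> \<le>o add \<XX> \<DD>)"
proof (intro conjI impI)
  obtain F where F: "F \<subseteq> \<XX>" "dominating (\<Union>F)" "add \<XX> \<DD> = |F|"
    using add_attained by blast
  {
    assume depth: "depth infinite_sets <o \<dd>"
    have "\<not> |F| <o \<dd>"
    proof
      assume "|F| <o \<dd>"
      moreover have iso: "|Field (depth infinite_sets)| =o depth infinite_sets"
        by (rule card_of_Field_ordIso[OF Card_order_depth])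
      \<comment> \<open>The depth itself, realised as the cardinal of its field, is the uniform
        bound for all \<open>C Y\<close>.\<close>
      have "|Field (depth infinite_sets)| <o \<dd> \<and> (\<forall>Y\<in>F. |C Y| \<le>o |Field (depth infinite_sets)| )"
        if "\<And>Y. Y \<in> F \<Longrightarrow> |C Y| <o depth infinite_sets" for C :: "(nat \<Rightarrow> nat) set \<Rightarrow> nat set set"
        using that iso depth ordIso_ordLess_trans ordLess_imp_ordLeq ordLeq_ordIso_trans
          ordIso_symmetric by blast
      ultimately show False using F(1,2) Union_not_dominating[of F] by blast
    qed
    then have "\<dd> \<le>o |F|"
      using Card_order_dom_number by (metis card_of_Well_order card_order_on_def not_ordLess_iff_ordLeq)
    then show "add \<XX> \<DD> =o \<dd>" using add_le_dom_number F(3) by (simp add: ordIso_iff_ordLeq)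
  next
    assume depth: "depth infinite_sets =o \<dd>"
    have "\<not> |F| <o cf \<dd>"
    proof
      assume small: "|F| <o cf \<dd>"
      then have "|F| <o \<dd>" using cf_le_dom_number by (rule ordLess_ordLeq_trans)
      \<comment> \<open>Here the depth is \<dd> and is too large to serve as the bound; a smaller
        one comes from the cofinality of \<dd>.\<close>
      moreover have "\<exists>B :: (nat \<Rightarrow> nat) set. |B| <o \<dd> \<and> (\<forall>Y\<in>F. |C Y| \<le>o |B| )"
        if "\<And>Y. Y \<in> F \<Longrightarrow> |C Y| <o depth infinite_sets" for C :: "(nat \<Rightarrow> nat) set \<Rightarrow> nat set set"
        using uniform_bound_below_cf[OF small] that depth ordLess_ordIso_trans by blast
      ultimately show False using F(1,2) Union_not_dominating[of F] by blast
    qed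
    moreover have "Well_order (cf \<dd>)" using cf_attained card_of_Well_order by metis
    ultimately show "cf \<dd> \<le>o add \<XX> \<DD>"
      using F(3) by (metis card_of_Well_order not_ordLess_iff_ordLeq)
  }
qed

end
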